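(* For each of the triplets $(e,12,12)$, $(e,12,123)$, $(e,12,132)$, $(e,13,123)$, $(e,13,132)$, $(e,23,12)$, $(e,23,123)$, $(e,23,132)$, $(e,123,12)$, $(e,123,123)$, $(e,123,132)$, the minimal terms of the TRIP-Stern tree lie on the left-most path: for every $n\ge0$, the minimum $b_n=\min_{|v|=n}\min_{i}b_i(v)$ is attained as an entry of $(1,1,1)F_0^n$.
   Context: Let $A_0=\begin{pmatrix}0&0&1\\1&0&0\\0&1&1\end{pmatrix}$, $A_1=\begin{pmatrix}1&0&1\\0&1&0\\0&0&1\end{pmatrix}$. Elements of $S_3$ are identified with permutation matrices: $e=I$, $(12)=\begin{pmatrix}0&1&0\\1&0&0\\0&0&1\end{pmatrix}$, $(13)=\begin{pmatrix}0&0&1\\0&1&0\\1&0&0\end{pmatrix}$, $(23)=\begin{pmatrix}1&0&0\\0&0&1\\0&1&0\end{pmatrix}$, $(123)=\begin{pmatrix}0&1&0\\0&0&1\\1&0&0\end{pmatrix}$, $(132)=\begin{pmatrix}0&0&1\\1&0&0\\0&1&0\end{pmatrix}$. For $(\sigma,\tau_0,\tau_1)\in S_3^3$ put $F_0=\sigma A_0\tau_0$, $F_1=\sigma A_1\tau_1$. For $v=(i_1,\dots,i_n)\in\{0,1\}^n$ let $\triangle(v)=(1,1,1)F_{i_1}\cdots F_{i_n}=(b_1(v),b_2(v),b_3(v))$; level $n$ of the TRIP-Stern tree consists of the $\triangle(v)$ with $|v|=n$, and the left-most node of level $n$ is $(1,1,1)F_0^n$. *)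

theory Defs
  imports "HOL-Analysis.Analysis"
begin

text \<open>
  Matrices are written row by row: \<open>M $ i $ j\<close> is the entry in row \<open>i\<close>, column \<open>j\<close>.
  Triples are row vectors and matrices act on them from the right, via \<open>v*\<close>.
\<close>

type_synonym mat3 = "int ^ 3 ^ 3"

definition A0 :: mat3 where
  "A0 = vector [vector [0, 0, 1],
                vector [1, 0, 0],
                vector [0, 1, 1]]"

definition A1 :: mat3 where
  "A1 = vector [vector [1, 0, 1],
                vector [0, 1, 0],
                vector [0, 0, 1]]"

definition p_e :: mat3 where
  "p_e = mat 1"

definition p_12 :: mat3 where
  "p_12 = vector [vector [0, 1, 0],
                  vector [1, 0, 0],
                  vector [0, 0, 1]]"

definition p_13 :: mat3 where
  "p_13 = vector [vector [0, 0, 1],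
                  vector [0, 1, 0],
                  vector [1, 0, 0]]"

definition p_23 :: mat3 where
  "p_23 = vector [vector [1, 0, 0],
                  vector [0, 0, 1],
                  vector [0, 1, 0]]"

definition p_123 :: mat3 where
  "p_123 = vector [vector [0, 1, 0],
                   vector [0, 0, 1],
                   vector [1, 0, 0]]"

definition p_132 :: mat3 where
  "p_132 = vector [vector [0, 0, 1],
                   vector [1, 0, 0],
                   vector [0, 1, 0]]"

definition F0 :: "mat3 \<times> mat3 \<times> mat3 \<Rightarrow> mat3" where
  "F0 = (\<lambda>(\<sigma>, \<tau>0, \<tau>1). \<sigma> ** A0 ** \<tau>0)"

definition F1 :: "mat3 \<times> mat3 \<times> mat3 \<Rightarrow> mat3" where
  "F1 = (\<lambda>(\<sigma>, \<tau>0, \<tau>1). \<sigma> ** A1 ** \<tau>1)"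

text \<open>The index is meant to be 0 or 1 only; see \<open>words\<close>.\<close>

definition F :: "mat3 \<times> mat3 \<times> mat3 \<Rightarrow> nat \<Rightarrow> mat3" where
  "F t i = (if i = 0 then F0 t else F1 t)"

definition words :: "nat \<Rightarrow> nat list set" where
  "words n = {v. length v = n \<and> set v \<subseteq> {0, 1}}"

definition ones :: "int ^ 3" where
  "ones = vector [1, 1, 1]"

definition triangle :: "mat3 \<times> mat3 \<times> mat3 \<Rightarrow> nat list \<Rightarrow> int ^ 3" where
  "triangle t v = ones v* foldr (\<lambda>i M. F t i ** M) v (mat 1)"

text \<open>
  Powers with respect to the matrix product \<open>**\<close>; the operators \<open>*\<close> and \<open>^\<close> on the type
  \<^typ>\<open>mat3\<close> would be componentwise.
\<close>

primrec matpow :: "mat3 \<Rightarrow> nat \<Rightarrow> mat3" where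
  "matpow M 0 = mat 1"
| "matpow M (Suc n) = M ** matpow M n"

definition leftmost :: "mat3 \<times> mat3 \<times> mat3 \<Rightarrow> nat \<Rightarrow> int ^ 3" where
  "leftmost t n = ones v* matpow (F0 t) n"

definition level_min :: "mat3 \<times> mat3 \<times> mat3 \<Rightarrow> nat \<Rightarrow> int" where
  "level_min t n = Min ((\<lambda>v. Min (range (\<lambda>i. triangle t v $ i))) ` words n)"

text \<open>
  The outer minimum is over a finite nonempty set (the inner one trivially so), and the
  left-most node is the node of level \<open>n\<close> whose address consists of zeros.
\<close>

lemma finite_words: "finite (words n)"
  using finite_lists_length_eq[of "{0, 1 :: nat}" n] by (simp add: words_def conj_commute)

lemma replicate_in_words: "replicate n 0 \<in> words n"
  by (auto simp: words_def)

lemma leftmost_eq_triangle: "leftmost t n = triangle t (replicate n 0)"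
proof -
  have "foldr (\<lambda>i M. F t i ** M) (replicate n 0) (mat 1) = matpow (F0 t) n"
    by (induction n) (simp_all add: F_def)
  then show ?thesis by (simp add: leftmost_def triangle_def)
qed

end

theory Submission
  imports Defs
begin

text \<open>
  With \<open>\<sigma> = e\<close>, every column of \<open>F\<^sub>0\<close> and \<open>F\<^sub>1\<close> is a unit vector or a sum of two of them, so all
  entries of the tree are positive integers. For each of the four \<open>\<tau>\<^sub>0\<close> that occur, \<open>F\<^sub>0\<close> fixes one
  entry of \<open>(b\<^sub>1, b\<^sub>2, b\<^sub>3)\<close> or, for \<open>\<tau>\<^sub>0 = (13)\<close>, swaps two of them. Hence the entry 1 of the root
  survives along the left-most path, and the minimum of every level is 1.
\<close>

text \<open>By associativity the row vector absorbs the factors one at a time from the left, so the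
  induction runs over an arbitrary start vector \<open>x\<close> instead of
  \<open>ones\<close>.\<close>

lemma triangle_invariant:
  assumes "P ones" and step: "\<And>i x. i \<in> set v \<Longrightarrow> P x \<Longrightarrow> P (x v* F t i)"
  shows "P (triangle t v)"
proof -
  have "P (x v* foldr (\<lambda>i M. F t i ** M) v (mat 1))" if "P x" for x
    using step that
    by (induction v arbitrary: x) (simp_all flip: vector_matrix_mul_assoc)
  with \<open>P ones\<close> show ?thesis by (simp add: triangle_def)
qed

lemma leftmost_invariant:
  assumes "P ones" and "\<And>x. P x \<Longrightarrow> P (x v* F0 t)"
  shows "P (leftmost t n)"
  unfolding leftmost_eq_triangle
  by (rule triangle_invariant) (use assms in \<open>auto simp: F_def\<close>)

lemma ones_nth [simp]: "ones $ i = 1"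
  using exhaust_3[of i] by (auto simp: ones_def)

lemma vector_mult_A0: "x v* A0 = vector [x $ 2, x $ 3, x $ 1 + x $ 3]"
  by (simp add: vec_eq_iff forall_3 vector_matrix_mult_def sum_3 A0_def)

lemma vector_mult_A1: "x v* A1 = vector [x $ 1, x $ 2, x $ 1 + x $ 3]"
  by (simp add: vec_eq_iff forall_3 vector_matrix_mult_def sum_3 A1_def)

lemma vector_mult_perm:
  fixes x :: "int ^ 3"
  shows "x v* p_e = x"
    and "x v* p_12 = vector [x $ 2, x $ 1, x $ 3]"
    and "x v* p_13 = vector [x $ 3, x $ 2, x $ 1]"
    and "x v* p_23 = vector [x $ 1, x $ 3, x $ 2]"
    and "x v* p_123 = vector [x $ 3, x $ 1, x $ 2]"
    and "x v* p_132 = vector [x $ 2, x $ 3, x $ 1]"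
  by (simp_all add: vec_eq_iff forall_3 vector_matrix_mult_def sum_3
      p_e_def p_12_def p_13_def p_23_def p_123_def p_132_def mat_def)

lemmas vector_mult_F =
  F0_def F1_def vector_mult_A0 vector_mult_A1 vector_mult_perm

lemma level_min_eq_1:
  assumes pos: "\<And>v j. v \<in> words n \<Longrightarrow> 1 \<le> triangle t v $ j"
    and i: "leftmost t n $ i = 1"
  shows "level_min t n = 1"
  unfolding level_min_def
proof (rule Min_eqI)
  let ?m = "\<lambda>v. Min (range (\<lambda>i. triangle t v $ i))"
  show "finite (?m ` words n)"
    by (simp add: finite_words)
  show "1 \<le> y" if "y \<in> ?m ` words n" for y
    using that pos by auto
  have "?m (replicate n 0) = 1"
    by (rule Min_eqI) (use pos[OF replicate_in_words] rangeI[of "\<lambda>i. leftmost t n $ i" i] i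
        in \<open>auto simp: leftmost_eq_triangle\<close>)
  then show "1 \<in> ?m ` words n"
    by (intro image_eqI[OF _ replicate_in_words]) simp
qed

theorem theorem16:
  fixes t :: "mat3 \<times> mat3 \<times> mat3" and n :: nat
  assumes "t \<in> {(p_e, p_12, p_12), (p_e, p_12, p_123), (p_e, p_12, p_132),
                (p_e, p_13, p_123), (p_e, p_13, p_132),
                (p_e, p_23, p_12), (p_e, p_23, p_123), (p_e, p_23, p_132),
                (p_e, p_123, p_12), (p_e, p_123, p_123), (p_e, p_123, p_132)}"
  shows "\<exists>i. leftmost t n $ i = level_min t n"
proof -
  \<comment> \<open>\<open>F0 t\<close> involves only \<tau>0 and \<open>F1 t\<close> only \<tau>1,
    so the two ranges can be treated separately.\<close>
  obtain \<tau>0 \<tau>1 where t: "t = (p_e, \<tau>0, \<tau>1)"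
    and \<tau>0: "\<tau>0 \<in> {p_12, p_13, p_23, p_123}" and \<tau>1: "\<tau>1 \<in> {p_12, p_123, p_132}"
    using assms by auto
  have "\<forall>j. 1 \<le> triangle t v $ j" for v
  proof (rule triangle_invariant)
    show "\<forall>j. 1 \<le> (x v* F t i) $ j" if "\<forall>j. 1 \<le> x $ j" for i x
    proof -
      have "1 \<le> x $ 1" "1 \<le> x $ 2" "1 \<le> x $ 3"
        using that by auto
      then show ?thesis
        using \<tau>0 \<tau>1
        by (auto simp: t F_def vector_mult_F forall_3 simp flip: vector_matrix_mul_assoc)
    qed
  qed simp
  moreover have "\<exists>i. leftmost t n $ i = 1"
  proof -
    \<comment> \<open>\<open>F0 t\<close> sends (a, b, c) to (c, b, a+c) for \<open>p_12\<close>,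
      (a+c, b, c) for \<open>p_123\<close>, (a+c, c, b) for \<open>p_13\<close> and (b, a+c, c) for
      \<open>p_23\<close>.\<close>
    consider "\<tau>0 \<in> {p_12, p_123}" | "\<tau>0 = p_13" | "\<tau>0 = p_23"
      using \<tau>0 by auto
    then show ?thesis
    proof cases
      case 1
      have "leftmost t n $ 2 = 1"
        by (rule leftmost_invariant)
          (use 1 in \<open>auto simp: t vector_mult_F simp flip: vector_matrix_mul_assoc\<close>)
      then show ?thesis ..
    next
      case 2
      \<comment> \<open>Entries 2 and 3 trade places at each step, so only the conjunction is an
        invariant.\<close>
      have "leftmost t n $ 2 = 1 \<and> leftmost t n $ 3 = 1"
        by (rule leftmost_invariant)
          (use 2 in \<open>auto simp: t vector_mult_F simp flip: vector_matrix_mul_assoc\<close>)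
      then show ?thesis by blast
    next
      case 3
      have "leftmost t n $ 3 = 1"
        by (rule leftmost_invariant)
          (use 3 in \<open>auto simp: t vector_mult_F simp flip: vector_matrix_mul_assoc\<close>)
      then show ?thesis ..
    qed
  qed
  ultimately show ?thesis
    using level_min_eq_1 by metis
qed

end
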